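(* Let $(M,\tau)$ be a finite von Neumann algebra with faithful normal tracial state $\tau$, and let $P,Q\subseteq M$ be diffuse von Neumann subalgebras that are orthogonal. Then $\mathrm{d}_{\mathrm{KK}}(P,Q)=1=\mathrm{d}_{\mathrm{MT}}(P,Q)$.
   Context: Subalgebras are unital. $P$ and $Q$ are orthogonal (in the sense of Popa) if $\tau(xy)=0$ whenever $x\in P$, $y\in Q$ satisfy $\tau(x)=\tau(y)=0$. Distances: $(X)_1$ denotes the operator-norm closed unit ball of $X$. $\mathrm{d}_{\mathrm{KK}}(P,Q)=\max\{\sup_{x\in(P)_1}\inf_{y\in(Q)_1}\|x-y\|,\ \sup_{y\in(Q)_1}\inf_{x\in(P)_1}\|x-y\|\}$ (operator norm), and $\mathrm{d}_{\mathrm{MT}}(P,Q)$ is given by the same formula with $\|x-y\|$ replaced by $\|x-y\|_\tau$, where $\|x\|_\tau=\tau(x^*x)^{1/2}$. *)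

theory Defs
  imports "HOL-Analysis.Analysis"
begin

class complex_hilbert_space = real_normed_vector + complete_space +
  fixes scaleC :: "complex \<Rightarrow> 'a \<Rightarrow> 'a"  (infixr "*\<^sub>C" 75)
    and cinner :: "'a \<Rightarrow> 'a \<Rightarrow> complex"
  assumes scaleC_add_right: "a *\<^sub>C (x + y) = a *\<^sub>C x + a *\<^sub>C y"
    and scaleC_add_left: "(a + b) *\<^sub>C x = a *\<^sub>C x + b *\<^sub>C x"
    and scaleC_scaleC: "a *\<^sub>C (b *\<^sub>C x) = (a * b) *\<^sub>C x"
    and scaleC_of_real: "complex_of_real r *\<^sub>C x = r *\<^sub>R x"
    and cinner_commute: "cinner x y = cnj (cinner y x)"
    and cinner_add_left: "cinner (x + y) z = cinner x z + cinner y z"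
    and cinner_scaleC_left: "cinner (a *\<^sub>C x) y = a * cinner x y"
    and cinner_ge_zero: "0 \<le> Re (cinner x x)"
    and norm_eq_sqrt_cinner: "norm x = sqrt (Re (cinner x x))"

instantiation complex :: complex_hilbert_space
begin
definition scaleC_complex :: "complex \<Rightarrow> complex \<Rightarrow> complex" where
  "scaleC_complex a x = a * x"
definition cinner_complex :: "complex \<Rightarrow> complex \<Rightarrow> complex" where
  "cinner_complex x y = x * cnj y"
instance
  by standard
    (auto simp: scaleC_complex_def cinner_complex_def algebra_simps scaleR_conv_of_real
      cmod_def power2_eq_square)
end

lemma cinner_add_right: "cinner x (y + z) = cinner x y + cinner (x::'a::complex_hilbert_space) z"
  by (metis cinner_add_left cinner_commute complex_cnj_add)

lemma cinner_scaleC_right: "cinner x (a *\<^sub>C y) = cnj a * cinner (x::'a::complex_hilbert_space) y"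
  by (metis cinner_commute cinner_scaleC_left complex_cnj_mult)

lemma cinner_scaleR_left: "cinner (r *\<^sub>R x) y = of_real r * cinner (x::'a::complex_hilbert_space) y"
  by (metis cinner_scaleC_left scaleC_of_real)

lemma cinner_scaleR_right: "cinner x (r *\<^sub>R y) = of_real r * cinner (x::'a::complex_hilbert_space) y"
  by (metis cinner_scaleC_right complex_cnj_complex_of_real scaleC_of_real)

lemma cinner_minus_left: "cinner (- x) y = - cinner (x::'a::complex_hilbert_space) y"
  using cinner_scaleR_left[of "-1" x y] by simp

lemma cinner_minus_right: "cinner x (- y) = - cinner (x::'a::complex_hilbert_space) y"
  using cinner_scaleR_right[of x "-1" y] by simp

lemma cinner_diff_left: "cinner (x - y) z = cinner x z - cinner (y::'a::complex_hilbert_space) z"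
  using cinner_add_left[of x "- y" z] by (simp add: cinner_minus_left)

lemma cinner_diff_right: "cinner z (x - y) = cinner z x - cinner (z::'a::complex_hilbert_space) y"
  using cinner_add_right[of z x "- y"] by (simp add: cinner_minus_right)

lemma Re_cinner_self: "Re (cinner x x) = (norm (x::'a::complex_hilbert_space))\<^sup>2"
  by (simp add: norm_eq_sqrt_cinner cinner_ge_zero)

lemma norm_scaleC: "norm (a *\<^sub>C x) = cmod a * norm (x::'a::complex_hilbert_space)"
proof -
  have "cinner (a *\<^sub>C x) (a *\<^sub>C x) = complex_of_real ((cmod a)\<^sup>2) * cinner x x"
    by (simp add: cinner_scaleC_left cinner_scaleC_right complex_norm_square mult.assoc del: of_real_power)
  then have "(norm (a *\<^sub>C x))\<^sup>2 = (cmod a * norm x)\<^sup>2"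
    by (simp add: Re_cinner_self[symmetric] power_mult_distrib del: of_real_power)
  then show ?thesis
    by (simp add: power2_eq_iff_nonneg)
qed

text \<open>Elements of \<^typ>\<open>'h \<Rightarrow>\<^sub>L 'h\<close> are only real linear; \<open>B(H)\<close> is the subset
  \<open>clinear_ops\<close>, with the norm of \<^typ>\<open>'h \<Rightarrow>\<^sub>L 'h\<close> as operator norm.\<close>

definition clinear_ops :: "('h::complex_hilbert_space \<Rightarrow>\<^sub>L 'h) set" where
  "clinear_ops = {T :: 'h \<Rightarrow>\<^sub>L 'h. \<forall>c x. T (c *\<^sub>C x) = c *\<^sub>C T x}"

lift_definition op_scaleC :: "complex \<Rightarrow> ('h::complex_hilbert_space \<Rightarrow>\<^sub>L 'h) \<Rightarrow> ('h \<Rightarrow>\<^sub>L 'h)"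
  is "\<lambda>c T x. c *\<^sub>C T x"
proof -
  fix c :: complex and T :: "'h \<Rightarrow> 'h"
  assume T: "bounded_linear T"
  then obtain K where K: "\<And>x. norm (T x) \<le> norm x * K"
    using bounded_linear.bounded by blast
  show "bounded_linear (\<lambda>x. c *\<^sub>C T x)"
  proof (rule bounded_linear_intro[where K = "cmod c * K"])
    show "c *\<^sub>C T (x + y) = c *\<^sub>C T x + c *\<^sub>C T y" for x y
      by (simp add: linear_add[OF bounded_linear.linear[OF T]] scaleC_add_right)
    show "c *\<^sub>C T (r *\<^sub>R x) = r *\<^sub>R (c *\<^sub>C T x)" for r x
      unfolding linear_scale[OF bounded_linear.linear[OF T]]
      by (simp add: scaleC_of_real[symmetric] scaleC_scaleC mult.commute)
    show "norm (c *\<^sub>C T x) \<le> norm x * (cmod c * K)" for x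
      using mult_left_mono[OF K[of x], of "cmod c"] by (simp add: norm_scaleC algebra_simps)
  qed
qed

definition adj :: "('h::complex_hilbert_space \<Rightarrow>\<^sub>L 'h) \<Rightarrow> ('h \<Rightarrow>\<^sub>L 'h)" where
  "adj T = (THE S :: 'h \<Rightarrow>\<^sub>L 'h. \<forall>x y. cinner (S x) y = cinner x (T y))"

lemma norm_add_sq:
  "(norm (x + y))\<^sup>2 = (norm x)\<^sup>2 + 2 * Re (cinner x y) + (norm (y::'a::complex_hilbert_space))\<^sup>2"
proof -
  have "Re (cinner y x) = Re (cinner x y)"
    using cinner_commute[of y x] by simp
  then show ?thesis
    by (simp add: Re_cinner_self[symmetric] cinner_add_left cinner_add_right)
qed

lemma riesz_real:
  fixes f :: "'a::complex_hilbert_space \<Rightarrow> real"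
  assumes f: "bounded_linear f"
  shows "\<exists>z. \<forall>y. Re (cinner z y) = f y"
proof -
  obtain K where K: "\<And>x. norm (f x) \<le> norm x * K"
    using f bounded_linear.bounded by blast
  note f_add = linear_add[OF bounded_linear.linear[OF f]]
  note f_scale = linear_scale[OF bounded_linear.linear[OF f]]
  define q where "q = (\<lambda>z. (norm z)\<^sup>2 - 2 * f z)"
  have "- K\<^sup>2 \<le> q z" for z
  proof -
    have "f z \<le> norm z * K"
      using K[of z] by simp
    moreover have "0 \<le> (norm z - K)\<^sup>2"
      by simp
    ultimately show ?thesis
      by (simp add: q_def power2_diff)
  qed
  then have bdd: "bdd_below (range q)"
    by (intro bdd_belowI2)
  define m where "m = (INF z. q z)"
  have m_le: "m \<le> q z" for z
    unfolding m_def by (rule cINF_lower[OF bdd]) simp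
  have "\<exists>z. q z < m + 1 / real (Suc n)" for n
    using cINF_less_iff[OF _ bdd, of "m + 1 / real (Suc n)"] by (auto simp: m_def)
  then obtain z where z: "\<And>n. q (z n) < m + 1 / real (Suc n)"
    by metis
  have par: "(norm (a - b))\<^sup>2 \<le> 2 * (q a - m) + 2 * (q b - m)" for a b
  proof -
    have "m \<le> q ((1/2) *\<^sub>R (a + b))"
      by (rule m_le)
    also have "\<dots> = (norm (a + b))\<^sup>2 / 4 - (f a + f b)"
      by (simp only: q_def f_scale f_add norm_scaleR power_mult_distrib) (simp add: power2_eq_square field_simps)
    finally have "m \<le> (norm (a + b))\<^sup>2 / 4 - (f a + f b)" .
    moreover have "(norm (a - b))\<^sup>2 = 2 * (norm a)\<^sup>2 + 2 * (norm b)\<^sup>2 - (norm (a + b))\<^sup>2"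
      using norm_add_sq[of a b] norm_add_sq[of a "- b"] by (simp add: cinner_minus_right)
    ultimately show ?thesis
      by (simp add: q_def algebra_simps)
  qed
  have aux: "A < E" if "A \<le> 2 * (p - m) + 2 * (r - m)" "p < m + s" "r < m + t" "s \<le> u" "t \<le> u" "u < E / 4"
    for A E p r s t u :: real
    using that by (simp add: algebra_simps)
  have "Cauchy z"
  proof (rule metric_CauchyI)
    fix e :: real assume "0 < e"
    then obtain N where N: "1 / real (Suc N) < e\<^sup>2 / 4"
      using nat_approx_posE[of "e\<^sup>2 / 4"] by (metis zero_less_divide_iff zero_less_numeral zero_less_power)
    have "dist (z i) (z j) < e" if "N \<le> i" "N \<le> j" for i j
    proof -
      have "1 / real (Suc i) \<le> 1 / real (Suc N)" "1 / real (Suc j) \<le> 1 / real (Suc N)"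
        using that by (auto intro!: divide_left_mono)
      then have "(norm (z i - z j))\<^sup>2 < e\<^sup>2"
        by (intro aux[OF par z z _ _ N])
      then show ?thesis
        using \<open>0 < e\<close> by (simp add: dist_norm power_less_imp_less_base)
    qed
    then show "\<exists>N. \<forall>i\<ge>N. \<forall>j\<ge>N. dist (z i) (z j) < e"
      by blast
  qed
  then obtain l where l: "z \<longlonglongrightarrow> l"
    using Cauchy_convergent convergent_def by blast
  have "(\<lambda>n. q (z n)) \<longlonglongrightarrow> q l"
    unfolding q_def by (intro tendsto_intros l bounded_linear.tendsto[OF f])
  moreover have "(\<lambda>n. m + 1 / real (Suc n)) \<longlonglongrightarrow> m + 0"
    by (intro tendsto_intros LIMSEQ_Suc[OF lim_1_over_n])
  ultimately have "q l \<le> m + 0"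
    by (rule LIMSEQ_le) (use z less_imp_le in blast)
  then have ql: "q l \<le> q x" for x
    using m_le[of x] by simp
  have "Re (cinner l y) = f y" for y
  proof -
    define d where "d = Re (cinner l y) - f y"
    have *: "0 \<le> 2 * t * d + t\<^sup>2 * (norm y)\<^sup>2" for t
      using ql[of "l + t *\<^sub>R y"]
      by (simp add: q_def norm_add_sq f_add f_scale cinner_scaleR_right d_def power_mult_distrib
          algebra_simps)
    define B where "B = (norm y)\<^sup>2 + 1"
    have B: "0 < B" "(norm y)\<^sup>2 = B - 1"
      by (simp_all add: B_def add_nonneg_pos)
    have "0 \<le> 2 * (- d / B) * d + (- d / B)\<^sup>2 * (B - 1)"
      using *[of "- d / B"] B(2) by simp
    also have "\<dots> = - (d\<^sup>2 * (B + 1) / B\<^sup>2)"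
      using B(1) by (simp add: field_simps power2_eq_square)
    finally have "d\<^sup>2 * (B + 1) \<le> 0"
      using B(1) by (simp add: divide_le_0_iff)
    then have "d\<^sup>2 \<le> 0"
      using B(1) by (simp add: mult_le_0_iff)
    then show ?thesis
      by (simp add: d_def)
  qed
  then show ?thesis
    by blast
qed

lemma cinner_eqI:
  assumes "\<And>y. cinner x y = cinner (x'::'a::complex_hilbert_space) y"
  shows "x = x'"
proof -
  have "(norm (x - x'))\<^sup>2 = 0"
    unfolding Re_cinner_self[symmetric] cinner_diff_left assms by simp
  then show ?thesis
    by simp
qed

lemma adj_ex1:
  fixes T :: "'h::complex_hilbert_space \<Rightarrow>\<^sub>L 'h"
  assumes T: "T \<in> clinear_ops"
  shows "\<exists>!S :: 'h \<Rightarrow>\<^sub>L 'h. \<forall>x y. cinner (S x) y = cinner x (T y)"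
proof -
  have cs: "cmod (cinner x y) \<le> norm x * norm y" for x y :: 'h
  proof -
    have re: "Re (cinner u v) \<le> norm u * norm v" for u v :: 'h
    proof -
      have "(norm (u + v))\<^sup>2 \<le> (norm u + norm v)\<^sup>2"
        by (simp add: norm_triangle_ineq power_mono)
      then show ?thesis
        by (simp add: norm_add_sq power2_sum)
    qed
    define c where "c = cnj (sgn (cinner x y))"
    have "cinner (c *\<^sub>C x) y = of_real (cmod (cinner x y))"
    proof (cases "cinner x y = 0")
      case False
      then show ?thesis
        by (simp add: c_def cinner_scaleC_left sgn_eq complex_norm_square[symmetric]
            power2_eq_square mult.commute[of "cnj _"])
    qed (simp add: cinner_scaleC_left)
    then have "cmod (cinner x y) \<le> cmod c * norm x * norm y"
      using re[of "c *\<^sub>C x" y] by (simp add: norm_scaleC)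
    also have "\<dots> \<le> 1 * norm x * norm y"
      by (intro mult_right_mono) (auto simp: c_def norm_sgn)
    finally show ?thesis by simp
  qed
  have "\<exists>z. \<forall>y. cinner z y = cinner x (T y)" for x
  proof -
    have "bounded_linear (\<lambda>y. Re (cinner x (T y)))"
    proof (rule bounded_linear_intro[where K = "norm x * norm T"])
      fix y
      have "norm (Re (cinner x (T y))) \<le> norm x * norm (T y)"
        using cs[of x "T y"] abs_Re_le_cmod[of "cinner x (T y)"] by simp
      also have "\<dots> \<le> norm x * (norm T * norm y)"
        by (intro mult_left_mono norm_blinfun) simp
      finally show "norm (Re (cinner x (T y))) \<le> norm y * (norm x * norm T)"
        by (simp add: algebra_simps)
    qed (simp_all add: blinfun.add_right blinfun.scaleR_right cinner_add_right cinner_scaleR_right)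
    from riesz_real[OF this] obtain z where z: "\<And>y. Re (cinner z y) = Re (cinner x (T y))"
      by blast
    have "cinner z y = cinner x (T y)" for y
    proof (rule complex_eqI)
      show "Im (cinner z y) = Im (cinner x (T y))"
        using z[of "\<i> *\<^sub>C y"] T by (simp add: clinear_ops_def cinner_scaleC_right)
    qed (rule z)
    then show ?thesis
      by blast
  qed
  then obtain S where S: "\<And>x y. cinner (S x) y = cinner x (T y)"
    by metis
  have "bounded_linear S"
  proof (rule bounded_linear_intro[where K = "norm T"])
    show "S (x + y) = S x + S y" for x y
      by (rule cinner_eqI) (simp add: S cinner_add_left)
    show "S (r *\<^sub>R x) = r *\<^sub>R S x" for r x
      by (rule cinner_eqI) (simp add: S cinner_scaleR_left)
    fix x
    have "norm (S x) * norm (S x) = Re (cinner x (T (S x)))"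
      by (metis S Re_cinner_self power2_eq_square)
    also have "\<dots> \<le> norm x * norm (T (S x))"
      using cs complex_Re_le_cmod order_trans by blast
    also have "\<dots> \<le> norm x * (norm T * norm (S x))"
      by (intro mult_left_mono norm_blinfun) simp
    finally have "norm (S x) * norm (S x) \<le> (norm x * norm T) * norm (S x)"
      by (simp add: mult.assoc)
    moreover have "0 \<le> norm x * norm T"
      by simp
    ultimately show "norm (S x) \<le> norm x * norm T"
      by (metis mult_right_le_imp_le norm_ge_zero order_le_less)
  qed
  then obtain S' :: "'h \<Rightarrow>\<^sub>L 'h" where S': "\<And>x. S' x = S x"
    by (metis bounded_linear_Blinfun_apply)
  show ?thesis
  proof (rule ex1I)
    show "\<forall>x y. cinner (S' x) y = cinner x (T y)"
      by (simp add: S S')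
    fix R :: "'h \<Rightarrow>\<^sub>L 'h"
    assume "\<forall>x y. cinner (R x) y = cinner x (T y)"
    then have "R x = S' x" for x
      using cinner_eqI[of "R x" "S' x"] by (simp add: S S')
    then show "R = S'"
      by (rule blinfun_eqI)
  qed
qed

lemma cinner_adj:
  assumes "T \<in> clinear_ops"
  shows "cinner (adj T x) y = cinner x (T y)"
  using theI'[OF adj_ex1[OF assms]] unfolding adj_def by blast

definition op_nonneg :: "('h::complex_hilbert_space \<Rightarrow>\<^sub>L 'h) \<Rightarrow> bool" where
  "op_nonneg T \<longleftrightarrow> (\<forall>x. cinner (T x) x \<in> \<real>\<^sub>\<ge>\<^sub>0)"

definition op_le :: "('h::complex_hilbert_space \<Rightarrow>\<^sub>L 'h) \<Rightarrow> ('h \<Rightarrow>\<^sub>L 'h) \<Rightarrow> bool" where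
  "op_le S T \<longleftrightarrow> op_nonneg (T - S)"

definition is_projection :: "('h::complex_hilbert_space \<Rightarrow>\<^sub>L 'h) \<Rightarrow> bool" where
  "is_projection p \<longleftrightarrow> p \<in> clinear_ops \<and> p o\<^sub>L p = p \<and> adj p = p"

definition von_neumann_algebra :: "('h::complex_hilbert_space \<Rightarrow>\<^sub>L 'h) set \<Rightarrow> bool" where
  "von_neumann_algebra M \<longleftrightarrow>
     M \<subseteq> clinear_ops \<and>
     id_blinfun \<in> M \<and>
     (\<forall>x\<in>M. \<forall>y\<in>M. x + y \<in> M) \<and>
     (\<forall>c. \<forall>x\<in>M. op_scaleC c x \<in> M) \<and>
     (\<forall>x\<in>M. \<forall>y\<in>M. x o\<^sub>L y \<in> M) \<and>
     (\<forall>x\<in>M. adj x \<in> M) \<and>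
     closedin strong_operator_topology M"

definition finite_von_neumann_algebra :: "('h::complex_hilbert_space \<Rightarrow>\<^sub>L 'h) set \<Rightarrow> bool" where
  "finite_von_neumann_algebra M \<longleftrightarrow>
     von_neumann_algebra M \<and>
     (\<forall>v\<in>M. adj v o\<^sub>L v = id_blinfun \<longrightarrow> v o\<^sub>L adj v = id_blinfun)"

text \<open>The identity of \<open>P\<close> is that of \<open>M\<close>, since both contain \<^const>\<open>id_blinfun\<close>.\<close>

definition von_neumann_subalgebra ::
    "('h::complex_hilbert_space \<Rightarrow>\<^sub>L 'h) set \<Rightarrow> ('h \<Rightarrow>\<^sub>L 'h) set \<Rightarrow> bool" where
  "von_neumann_subalgebra P M \<longleftrightarrow> von_neumann_algebra P \<and> P \<subseteq> M"

definition minimal_projection ::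
    "('h::complex_hilbert_space \<Rightarrow>\<^sub>L 'h) set \<Rightarrow> ('h \<Rightarrow>\<^sub>L 'h) \<Rightarrow> bool" where
  "minimal_projection P p \<longleftrightarrow>
     p \<in> P \<and> is_projection p \<and> p \<noteq> 0 \<and>
     (\<forall>q\<in>P. is_projection q \<and> op_le q p \<longrightarrow> q = 0 \<or> q = p)"

definition diffuse :: "('h::complex_hilbert_space \<Rightarrow>\<^sub>L 'h) set \<Rightarrow> bool" where
  "diffuse P \<longleftrightarrow> (\<nexists>p. minimal_projection P p)"

text \<open>A functional on \<open>M\<close> is a function on all operators; its values outside \<open>M\<close> play no role.\<close>

definition linear_functional_on ::
    "('h::complex_hilbert_space \<Rightarrow>\<^sub>L 'h) set \<Rightarrow> (('h \<Rightarrow>\<^sub>L 'h) \<Rightarrow> complex) \<Rightarrow> bool" where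
  "linear_functional_on M \<tau> \<longleftrightarrow>
     (\<forall>x\<in>M. \<forall>y\<in>M. \<tau> (x + y) = \<tau> x + \<tau> y) \<and>
     (\<forall>c. \<forall>x\<in>M. \<tau> (op_scaleC c x) = c * \<tau> x)"

definition state_on ::
    "('h::complex_hilbert_space \<Rightarrow>\<^sub>L 'h) set \<Rightarrow> (('h \<Rightarrow>\<^sub>L 'h) \<Rightarrow> complex) \<Rightarrow> bool" where
  "state_on M \<tau> \<longleftrightarrow>
     linear_functional_on M \<tau> \<and>
     (\<forall>x\<in>M. op_nonneg x \<longrightarrow> \<tau> x \<in> \<real>\<^sub>\<ge>\<^sub>0) \<and>
     \<tau> id_blinfun = 1"

definition faithful_on ::
    "('h::complex_hilbert_space \<Rightarrow>\<^sub>L 'h) set \<Rightarrow> (('h \<Rightarrow>\<^sub>L 'h) \<Rightarrow> complex) \<Rightarrow> bool" where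
  "faithful_on M \<tau> \<longleftrightarrow> (\<forall>x\<in>M. op_nonneg x \<and> \<tau> x = 0 \<longrightarrow> x = 0)"

definition tracial_on ::
    "('h::complex_hilbert_space \<Rightarrow>\<^sub>L 'h) set \<Rightarrow> (('h \<Rightarrow>\<^sub>L 'h) \<Rightarrow> complex) \<Rightarrow> bool" where
  "tracial_on M \<tau> \<longleftrightarrow> (\<forall>x\<in>M. \<forall>y\<in>M. \<tau> (x o\<^sub>L y) = \<tau> (y o\<^sub>L x))"

definition op_directed :: "('h::complex_hilbert_space \<Rightarrow>\<^sub>L 'h) set \<Rightarrow> bool" where
  "op_directed D \<longleftrightarrow> D \<noteq> {} \<and> (\<forall>x\<in>D. \<forall>y\<in>D. \<exists>z\<in>D. op_le x z \<and> op_le y z)"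

definition op_lub_in ::
    "('h::complex_hilbert_space \<Rightarrow>\<^sub>L 'h) set \<Rightarrow> ('h \<Rightarrow>\<^sub>L 'h) set \<Rightarrow> ('h \<Rightarrow>\<^sub>L 'h) \<Rightarrow> bool" where
  "op_lub_in M D s \<longleftrightarrow>
     s \<in> M \<and> (\<forall>x\<in>D. op_le x s) \<and> (\<forall>t\<in>M. (\<forall>x\<in>D. op_le x t) \<longrightarrow> op_le s t)"

text \<open>Normality: \<open>\<tau> (sup x\<^sub>i) = sup (\<tau> x\<^sub>i)\<close> for bounded increasing nets of positive elements.
  A positive functional is real on positive elements, so nothing is lost by taking real parts.\<close>

definition normal_on ::
    "('h::complex_hilbert_space \<Rightarrow>\<^sub>L 'h) set \<Rightarrow> (('h \<Rightarrow>\<^sub>L 'h) \<Rightarrow> complex) \<Rightarrow> bool" where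
  "normal_on M \<tau> \<longleftrightarrow>
     (\<forall>D s. D \<subseteq> M \<and> (\<forall>x\<in>D. op_nonneg x) \<and> op_directed D \<and> op_lub_in M D s \<longrightarrow>
        Re (\<tau> s) = (SUP x\<in>D. Re (\<tau> x)))"

definition orthogonal_subalgebras ::
    "(('h::complex_hilbert_space \<Rightarrow>\<^sub>L 'h) \<Rightarrow> complex) \<Rightarrow> ('h \<Rightarrow>\<^sub>L 'h) set \<Rightarrow> ('h \<Rightarrow>\<^sub>L 'h) set \<Rightarrow> bool" where
  "orthogonal_subalgebras \<tau> P Q \<longleftrightarrow>
     (\<forall>x\<in>P. \<forall>y\<in>Q. \<tau> x = 0 \<and> \<tau> y = 0 \<longrightarrow> \<tau> (x o\<^sub>L y) = 0)"

definition unit_ball :: "('h::complex_hilbert_space \<Rightarrow>\<^sub>L 'h) set \<Rightarrow> ('h \<Rightarrow>\<^sub>L 'h) set" where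
  "unit_ball X = {x \<in> X. norm x \<le> 1}"

definition trace_norm ::
    "(('h::complex_hilbert_space \<Rightarrow>\<^sub>L 'h) \<Rightarrow> complex) \<Rightarrow> ('h \<Rightarrow>\<^sub>L 'h) \<Rightarrow> real" where
  "trace_norm \<tau> x = sqrt (Re (\<tau> (adj x o\<^sub>L x)))"

definition d_KK ::
    "('h::complex_hilbert_space \<Rightarrow>\<^sub>L 'h) set \<Rightarrow> ('h \<Rightarrow>\<^sub>L 'h) set \<Rightarrow> real" where
  "d_KK P Q =
     max (SUP x\<in>unit_ball P. INF y\<in>unit_ball Q. norm (x - y))
         (SUP y\<in>unit_ball Q. INF x\<in>unit_ball P. norm (x - y))"

definition d_MT ::
    "(('h::complex_hilbert_space \<Rightarrow>\<^sub>L 'h) \<Rightarrow> complex) \<Rightarrow> ('h \<Rightarrow>\<^sub>L 'h) set \<Rightarrow> ('h \<Rightarrow>\<^sub>L 'h) set \<Rightarrow> real" where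
  "d_MT \<tau> P Q =
     max (SUP x\<in>unit_ball P. INF y\<in>unit_ball Q. trace_norm \<tau> (x - y))
         (SUP y\<in>unit_ball Q. INF x\<in>unit_ball P. trace_norm \<tau> (x - y))"

end

theory Submission
  imports Defs
begin

text \<open>
  Neither distance can exceed \<open>1\<close>: every element of a unit ball is within operator norm \<open>1\<close> of
  \<open>0\<close>, and the trace norm is dominated by the operator norm (\<open>trace_norm_le_norm\<close>).
  Because of this domination, both distances are at least \<open>1\<close> as soon as some \<open>u\<close> in the unit ball
  of \<open>P\<close> has trace-norm distance at least \<open>1\<close> from all of \<open>Q\<close>.

  A self-adjoint unitary \<open>u\<close> of \<open>P\<close> with \<open>\<tau>(u) = 0\<close> has this property. Orthogonality of the algebras
  gives \<open>\<tau>(u y) = 0\<close> for every \<open>y\<close> in \<open>Q\<close> (\<open>orthogonal_trace_compose_zero\<close>), so \<open>u\<close> is orthogonal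
  to \<open>Q\<close> in the inner product of the trace, and Pythagoras yields
  \<open>\<parallel>u - y\<parallel>\<^sub>\<tau>\<^sup>2 = 1 + \<parallel>y\<parallel>\<^sub>\<tau>\<^sup>2\<close> (\<open>ex_far_from_orthogonal\<close>).

  One obtains \<open>u\<close> as \<open>2 p - 1\<close> from a projection \<open>p\<close> in \<open>P\<close> of trace \<open>1/2\<close>, and this is where
  diffuseness enters. Since no projection is minimal, repeated halving produces nonzero projections of arbitrarily small trace below any given nonzero one
  (\<open>diffuse_small_subprojection\<close>). A greedily chosen increasing sequence of projections of trace at most
  \<open>1/2\<close> has a strong limit in \<open>P\<close>, whose trace is controlled by normality
  (\<open>increasing_projections_trace\<close>). If this limit had trace below \<open>1/2\<close>, a small projection from its
  complement could be added to it, and faithfulness would make the trace strictly larger, against the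
  greedy choice (\<open>diffuse_projection_of_trace\<close>).
\<close>

section \<open>Inner products, adjoints and projections\<close>

lemma cinner_self: "cinner x x = of_real ((norm (x::'a::complex_hilbert_space))\<^sup>2)"
proof (rule complex_eqI)
  show "Im (cinner x x) = Im (of_real ((norm x)\<^sup>2))"
    using arg_cong[OF cinner_commute[of x x], of Im] by simp
qed (simp add: Re_cinner_self del: of_real_power)

lemma cinner_zero_left: "cinner 0 (y::'a::complex_hilbert_space) = 0"
  using cinner_diff_left[of y y y] by simp

lemma cinner_zero_right: "cinner (y::'a::complex_hilbert_space) 0 = 0"
  using cinner_diff_right[of y y y] by simp

lemma scaleC_zero_right: "c *\<^sub>C (0::'a::complex_hilbert_space) = 0"
  using scaleC_add_right[of c "0::'a" 0] by simp

lemma scaleC_minus_right: "c *\<^sub>C (- x) = - (c *\<^sub>C (x::'a::complex_hilbert_space))"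
  using scaleC_add_right[of c x "- x"]
  by (simp add: scaleC_zero_right eq_neg_iff_add_eq_0 add.commute)

lemma scaleC_diff_right: "c *\<^sub>C (x - y) = c *\<^sub>C x - c *\<^sub>C (y::'a::complex_hilbert_space)"
  using scaleC_add_right[of c x "- y"] by (simp add: scaleC_minus_right)

text \<open>Polarization expresses the inner product through norms, so continuity of the norm suffices.\<close>

lemma tendsto_cinner_left:
  fixes y l :: "'a::complex_hilbert_space"
  assumes X: "(X \<longlongrightarrow> l) F"
  shows "((\<lambda>n. cinner (X n) y) \<longlongrightarrow> cinner l y) F"
proof -
  have polar: "Re (cinner x z) = ((norm (x + z))\<^sup>2 - (norm x)\<^sup>2 - (norm z)\<^sup>2) / 2" for x z :: 'a
    by (simp add: norm_add_sq)
  have re: "((\<lambda>n. Re (cinner (X n) z)) \<longlongrightarrow> Re (cinner l z)) F" for z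
    unfolding polar by (intro tendsto_intros X) simp
  have im: "Im (cinner x y) = Re (cinner x (\<i> *\<^sub>C y))" for x
    by (simp add: cinner_scaleC_right)
  show ?thesis
    unfolding tendsto_complex_iff im using re by blast
qed

lemma clinear_opsD: "T \<in> clinear_ops \<Longrightarrow> blinfun_apply T (c *\<^sub>C x) = c *\<^sub>C blinfun_apply T x"
  by (simp add: clinear_ops_def)

lemma adj_eqI:
  assumes "T \<in> clinear_ops" and "\<And>x y. cinner (blinfun_apply S x) y = cinner x (blinfun_apply T y)"
  shows "adj T = S"
  unfolding adj_def using the1_equality[OF adj_ex1[OF assms(1)]] assms(2) by blast

lemma is_projection_iff:
  "is_projection p \<longleftrightarrow>
     p \<in> clinear_ops \<and> (\<forall>x. p (p x) = p x) \<and> (\<forall>x y. cinner (p x) y = cinner x (p y))"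
proof
  assume p: "is_projection p"
  then have lin: "p \<in> clinear_ops" and idem: "p o\<^sub>L p = p" and adj: "adj p = p"
    by (auto simp: is_projection_def)
  have "p (p x) = p x" for x
    using arg_cong[OF idem, of "\<lambda>T. blinfun_apply T x"] by simp
  moreover have "cinner (p x) y = cinner x (p y)" for x y
    using cinner_adj[OF lin, of x y] by (simp add: adj)
  ultimately show "p \<in> clinear_ops \<and> (\<forall>x. p (p x) = p x) \<and> (\<forall>x y. cinner (p x) y = cinner x (p y))"
    using lin by blast
next
  assume p: "p \<in> clinear_ops \<and> (\<forall>x. p (p x) = p x) \<and> (\<forall>x y. cinner (p x) y = cinner x (p y))"
  then have "p o\<^sub>L p = p"
    by - (rule blinfun_eqI, simp)
  moreover have "adj p = p"
    using p by - (rule adj_eqI, auto)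
  ultimately show "is_projection p"
    using p by (simp add: is_projection_def)
qed

lemma cinner_projection:
  assumes "is_projection p"
  shows "cinner (p x) x = of_real ((norm (p x))\<^sup>2)"
  using assms cinner_self[of "p x"] by (metis is_projection_iff)

lemma op_nonneg_projection: "is_projection p \<Longrightarrow> op_nonneg p"
  unfolding op_nonneg_def by (simp add: cinner_projection del: of_real_power)

lemma norm_projection_le: "is_projection p \<Longrightarrow> norm (p x) \<le> norm x"
proof -
  assume p: "is_projection p"
  have "cinner (p x) (x - p x) = 0"
    using p by (simp add: is_projection_iff blinfun.diff_right cinner_zero_right)
  then have "(norm (p x + (x - p x)))\<^sup>2 = (norm (p x))\<^sup>2 + (norm (x - p x))\<^sup>2"
    unfolding norm_add_sq by simp
  then show ?thesis
    by (simp add: power2_le_imp_le)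
qed

lemma is_projection_0: "is_projection 0"
  by (simp add: is_projection_iff clinear_ops_def scaleC_zero_right cinner_zero_left cinner_zero_right)

lemma is_projection_id: "is_projection id_blinfun"
  by (simp add: is_projection_iff clinear_ops_def)

text \<open>If \<open>q \<le> p\<close>, then \<open>q\<close> vanishes on the kernel of \<open>p\<close>, that is \<open>q = q p\<close>; taking adjoints
  gives \<open>q = p q\<close>. Conversely, \<open>q = p q\<close> makes \<open>p - q\<close> a symmetric idempotent, so
  \<open>\<langle>(p - q) x, x\<rangle> = \<parallel>(p - q) x\<parallel>\<^sup>2\<close>.\<close>

lemma projection_op_le_iff:
  assumes p: "is_projection p" and q: "is_projection q"
  shows "op_le q p \<longleftrightarrow> (\<forall>x. p (q x) = q x)"
proof
  assume le: "op_le q p"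
  have qp: "q (p x) = q x" for x
  proof -
    define y where "y = x - p x"
    have py: "p y = 0"
      using p by (simp add: y_def is_projection_iff blinfun.diff_right)
    have "cinner ((p - q) y) y = of_real (- (norm (q y))\<^sup>2)"
      by (simp add: blinfun.diff_left py cinner_minus_left cinner_projection[OF q])
    moreover have "cinner ((p - q) y) y \<in> \<real>\<^sub>\<ge>\<^sub>0"
      using le by (simp only: op_le_def op_nonneg_def)
    ultimately have "0 \<le> - (norm (q y))\<^sup>2"
      by (metis nonneg_Reals_of_real_iff)
    then show ?thesis
      by (simp add: y_def blinfun.diff_right)
  qed
  show "\<forall>x. p (q x) = q x"
  proof
    fix x
    show "p (q x) = q x"
      using p q qp by - (rule cinner_eqI, simp add: is_projection_iff)
  qed
next
  assume pq: "\<forall>x. p (q x) = q x"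
  have qp: "q (p x) = q x" for x
    using p q pq by - (rule cinner_eqI, simp add: is_projection_iff)
  have "cinner ((p - q) x) x = of_real ((norm ((p - q) x))\<^sup>2)" for x
    using p q pq qp cinner_self[of "(p - q) x"]
    by (simp add: is_projection_iff blinfun.diff_left blinfun.diff_right cinner_diff_left cinner_diff_right)
  then show "op_le q p"
    unfolding op_le_def op_nonneg_def by (metis nonneg_Reals_of_real_iff zero_le_power2)
qed

lemma projection_op_le_absorb:
  assumes p: "is_projection p" and q: "is_projection q" and le: "op_le q p"
  shows "q (p x) = q x"
  using p q le by - (rule cinner_eqI, simp add: is_projection_iff projection_op_le_iff)

lemma op_le_refl: "op_le p p"
  by (simp add: op_le_def op_nonneg_def cinner_zero_left)

lemma op_le_trans:
  assumes "op_le p q" and "op_le q r"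
  shows "op_le p r"
  unfolding op_le_def op_nonneg_def
proof
  fix x
  have "cinner ((r - p) x) x = cinner ((q - p) x) x + cinner ((r - q) x) x"
    by (simp add: blinfun.diff_left cinner_diff_left)
  also have "\<dots> \<in> \<real>\<^sub>\<ge>\<^sub>0"
    using assms unfolding op_le_def op_nonneg_def by (intro nonneg_Reals_add_I) auto
  finally show "cinner ((r - p) x) x \<in> \<real>\<^sub>\<ge>\<^sub>0" .
qed

lemma op_le_of_step:
  assumes "\<And>n. op_le (p n) (p (Suc n))" and "m \<le> n"
  shows "op_le (p m) (p n)"
  using assms(2) by (induction n rule: dec_induct) (auto intro: op_le_refl op_le_trans assms(1))

lemma is_projection_diff:
  assumes p: "is_projection p" and q: "is_projection q" and le: "op_le q p"
  shows "is_projection (p - q)"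
  using p q projection_op_le_absorb[OF p q le] le
  by (simp add: is_projection_iff projection_op_le_iff[OF p q] clinear_ops_def blinfun.diff_left
      blinfun.diff_right scaleC_diff_right cinner_diff_left cinner_diff_right)

lemma op_le_diff_projection:
  assumes "is_projection q"
  shows "op_le (p - q) p"
  using op_nonneg_projection[OF assms] by (simp add: op_le_def)

lemma op_le_id_projection:
  assumes "is_projection p"
  shows "op_le p id_blinfun"
  using assms by (simp add: projection_op_le_iff[OF is_projection_id])

lemma is_projection_add:
  assumes p: "is_projection p" and r: "is_projection r" and le: "op_le r (id_blinfun - p)"
  shows "is_projection (p + r)" and "op_le p (p + r)"
proof -
  have c: "is_projection (id_blinfun - p)"
    by (intro is_projection_diff is_projection_id p op_le_id_projection)
  have "p (r x) = 0" for x
    using le unfolding projection_op_le_iff[OF c r] by (simp add: blinfun.diff_left)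
  moreover have "r (p x) = 0" for x
    using projection_op_le_absorb[OF c r le, of x] by (simp add: blinfun.diff_left blinfun.diff_right)
  ultimately show "is_projection (p + r)"
    using p r by (simp add: is_projection_iff clinear_ops_def blinfun.add_left
      blinfun.add_right scaleC_add_right cinner_add_left cinner_add_right)
  show "op_le p (p + r)"
    using op_nonneg_projection[OF r] by (simp add: op_le_def)
qed

section \<open>Monotone limits of projections\<close>

lemma closedin_strong_operator_topology_limit:
  fixes T :: "nat \<Rightarrow> ('a::real_normed_vector \<Rightarrow>\<^sub>L 'b::real_normed_vector)" and S :: "'a \<Rightarrow>\<^sub>L 'b"
  assumes cl: "closedin strong_operator_topology M" and T: "\<And>n. T n \<in> M"
    and lim: "\<And>x. (\<lambda>n. T n x) \<longlonglongrightarrow> S x"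
  shows "S \<in> M"
proof (rule limitin_closedin[OF _ cl])
  have "limitin euclidean (\<lambda>n. blinfun_apply (T n)) (blinfun_apply S) sequentially"
    unfolding euclidean_product_topology[symmetric] limitin_componentwise
    using lim by simp
  then show "limitin strong_operator_topology T S sequentially"
    unfolding limitin_def strong_operator_topology_def openin_pullback_topology topspace_pullback_topology
    by auto
qed (use T in auto)

text \<open>The squared norms \<open>\<parallel>p\<^sub>n x\<parallel>\<^sup>2\<close> increase and are bounded, and
  \<open>\<parallel>p\<^sub>n x - p\<^sub>m x\<parallel>\<^sup>2\<close> is the difference of two of them, so \<open>p\<^sub>n x\<close> is Cauchy.\<close>

lemma increasing_projections_converge:
  fixes p :: "nat \<Rightarrow> ('h::complex_hilbert_space \<Rightarrow>\<^sub>L 'h)"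
  assumes p: "\<And>n. is_projection (p n)" and inc: "\<And>n. op_le (p n) (p (Suc n))"
  obtains s where "is_projection s" "\<And>x. (\<lambda>n. p n x) \<longlonglongrightarrow> s x" "\<And>n. op_le (p n) s"
proof -
  have mono: "op_le (p m) (p n)" if "m \<le> n" for m n
    using op_le_of_step[of p] inc that by blast
  have absorb: "p n (p m x) = p m x" if "m \<le> n" for m n x
    using mono[OF that] projection_op_le_iff p by blast
  have pyth: "(norm (p n x))\<^sup>2 = (norm (p m x))\<^sup>2 + (norm (p n x - p m x))\<^sup>2" if "m \<le> n" for m n x
  proof -
    have "p m (p n x) = p m x"
      using projection_op_le_absorb[OF p p mono[OF that]] .
    then have "cinner (p m x) (p n x - p m x) = 0"
      using p[of m] by (simp add: is_projection_iff blinfun.diff_right cinner_zero_right)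
    then show ?thesis
      using norm_add_sq[of "p m x" "p n x - p m x"] by simp
  qed
  have "convergent (\<lambda>n. p n x)" for x
  proof -
    have "incseq (\<lambda>n. (norm (p n x))\<^sup>2)"
      using pyth by (auto simp: incseq_def)
    moreover have "(norm (p n x))\<^sup>2 \<le> (norm x)\<^sup>2" for n
      by (intro power_mono norm_projection_le p) simp
    ultimately obtain L where "(\<lambda>n. (norm (p n x))\<^sup>2) \<longlonglongrightarrow> L"
      using incseq_convergent[of "\<lambda>n. (norm (p n x))\<^sup>2" "(norm x)\<^sup>2"] by blast
    then have cauchy: "Cauchy (\<lambda>n. (norm (p n x))\<^sup>2)"
      by (rule LIMSEQ_imp_Cauchy)
    have "Cauchy (\<lambda>n. p n x)"
    proof (rule CauchyI')
      fix e :: real assume e: "0 < e"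
      then obtain N where N: "\<And>m n. m \<ge> N \<Longrightarrow> n \<ge> N \<Longrightarrow> \<bar>(norm (p m x))\<^sup>2 - (norm (p n x))\<^sup>2\<bar> < e\<^sup>2"
        using CauchyD[OF cauchy, of "e\<^sup>2"] by auto
      have "norm (p m x - p n x) < e" if "N \<le> m" "m < n" for m n
      proof -
        have "(norm (p n x - p m x))\<^sup>2 < e\<^sup>2"
          using N[of m n] pyth[of m n x] that by simp
        then show ?thesis
          using e by (metis norm_minus_commute order_less_imp_le power_less_imp_less_base)
      qed
      then show "\<exists>M. \<forall>m\<ge>M. \<forall>n>m. dist (p m x) (p n x) < e"
        unfolding dist_norm by blast
    qed
    then show ?thesis
      by (simp add: Cauchy_convergent_iff)
  qed
  then obtain S where S: "\<And>x. (\<lambda>n. p n x) \<longlonglongrightarrow> S x"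
    unfolding convergent_def by metis
  have "bounded_linear S"
  proof (rule bounded_linear_intro[where K = 1])
    show "S (x + y) = S x + S y" for x y
      using LIMSEQ_unique[OF S[of "x + y"]] tendsto_add[OF S[of x] S[of y]]
      by (simp add: blinfun.add_right)
    show "S (r *\<^sub>R x) = r *\<^sub>R S x" for r x
      using LIMSEQ_unique[OF S[of "r *\<^sub>R x"]] tendsto_scaleR[OF tendsto_const[of r] S[of x]]
      by (simp add: blinfun.scaleR_right)
    show "norm (S x) \<le> norm x * 1" for x
      by (rule LIMSEQ_le_const2[OF tendsto_norm[OF S]]) (auto intro: norm_projection_le p)
  qed
  then obtain s :: "'h \<Rightarrow>\<^sub>L 'h" where "\<And>x. s x = S x"
    by (metis bounded_linear_Blinfun_apply)
  with S have s: "(\<lambda>n. p n x) \<longlonglongrightarrow> s x" for x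
    by simp
  have "s (c *\<^sub>C x) = c *\<^sub>C s x" for c x
  proof (rule cinner_eqI)
    fix y
    have "(\<lambda>n. c * cinner (p n x) y) \<longlonglongrightarrow> c * cinner (s x) y"
      by (intro tendsto_mult_left tendsto_cinner_left s)
    moreover have "c * cinner (p n x) y = cinner (p n (c *\<^sub>C x)) y" for n
      using p[of n] by (simp add: is_projection_iff clinear_opsD cinner_scaleC_left)
    moreover have "(\<lambda>n. cinner (p n (c *\<^sub>C x)) y) \<longlonglongrightarrow> cinner (s (c *\<^sub>C x)) y"
      by (intro tendsto_cinner_left s)
    ultimately show "cinner (s (c *\<^sub>C x)) y = cinner (c *\<^sub>C s x) y"
      by (simp add: cinner_scaleC_left LIMSEQ_unique)
  qed
  then have lin: "s \<in> clinear_ops"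
    by (simp add: clinear_ops_def)
  have sym: "cinner (s x) y = cinner x (s y)" for x y
  proof -
    have "(\<lambda>n. cnj (cinner (p n y) x)) \<longlonglongrightarrow> cnj (cinner (s y) x)"
      by (intro tendsto_cnj tendsto_cinner_left s)
    moreover have "cnj (cinner (p n y) x) = cinner (p n x) y" for n
      using p[of n] by (metis cinner_commute is_projection_iff)
    ultimately have "cinner (s x) y = cnj (cinner (s y) x)"
      using tendsto_cinner_left[OF s[of x], of y] LIMSEQ_unique by auto
    then show ?thesis
      using cinner_commute by metis
  qed
  have s_p: "s (p m x) = p m x" for m x
  proof (rule LIMSEQ_unique[OF s])
    show "(\<lambda>n. p n (p m x)) \<longlonglongrightarrow> p m x"
      using absorb by (intro tendsto_eventually eventually_sequentiallyI[of m])
  qed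
  \<comment> \<open>\<open>s\<close> fixes the range of each \<open>p\<^sub>n\<close>, hence by continuity its own range.\<close>
  have "s (s x) = s x" for x
  proof (rule LIMSEQ_unique)
    show "(\<lambda>n. s (p n x)) \<longlonglongrightarrow> s (s x)"
      by (intro bounded_linear.tendsto[OF blinfun.bounded_linear_right] s)
  qed (simp add: s_p s)
  with lin sym have "is_projection s"
    by (simp add: is_projection_iff)
  moreover from this have "op_le (p n) s" for n
    using s_p p by (simp add: projection_op_le_iff)
  ultimately show thesis
    using s that by blast
qed

lemma op_le_limit:
  fixes p :: "nat \<Rightarrow> ('h::complex_hilbert_space \<Rightarrow>\<^sub>L 'h)" and s t :: "'h \<Rightarrow>\<^sub>L 'h"
  assumes lim: "\<And>x. (\<lambda>n. p n x) \<longlonglongrightarrow> s x" and le: "\<And>n. op_le (p n) t"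
  shows "op_le s t"
  unfolding op_le_def op_nonneg_def
proof
  fix x
  have "(\<lambda>n. cinner (t x) x - cinner (p n x) x) \<longlonglongrightarrow> cinner (t x) x - cinner (s x) x"
    by (intro tendsto_intros tendsto_cinner_left lim)
  moreover have "cinner (t x) x - cinner (p n x) x \<in> \<real>\<^sub>\<ge>\<^sub>0" for n
    using le[of n] by (simp add: op_le_def op_nonneg_def blinfun.diff_left cinner_diff_left)
  ultimately have "cinner (t x) x - cinner (s x) x \<in> \<real>\<^sub>\<ge>\<^sub>0"
    by - (rule closed_sequentially[OF closed_nonneg_Reals_complex])
  then show "cinner ((t - s) x) x \<in> \<real>\<^sub>\<ge>\<^sub>0"
    by (simp add: blinfun.diff_left cinner_diff_left)
qed

section \<open>Von Neumann algebras and positive functionals\<close>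

lemma op_scaleC_apply: "op_scaleC c T x = c *\<^sub>C T x"
  by transfer simp

lemma op_scaleC_of_real: "op_scaleC (of_real r) T = r *\<^sub>R T"
  by (rule blinfun_eqI) (simp add: op_scaleC_apply scaleC_of_real blinfun.scaleR_left)

lemma op_scaleC_minus_one: "op_scaleC (- 1) T = - T"
  using op_scaleC_of_real[of "- 1" T] by simp

lemma op_scaleC_two: "op_scaleC 2 T = T + T"
  using op_scaleC_of_real[of 2 T] by (simp add: scaleR_2)

lemma
  assumes "von_neumann_algebra M"
  shows vna_clinear: "x \<in> M \<Longrightarrow> x \<in> clinear_ops"
    and vna_id: "id_blinfun \<in> M"
    and vna_add: "x \<in> M \<Longrightarrow> y \<in> M \<Longrightarrow> x + y \<in> M"
    and vna_scaleC: "x \<in> M \<Longrightarrow> op_scaleC c x \<in> M"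
    and vna_compose: "x \<in> M \<Longrightarrow> y \<in> M \<Longrightarrow> x o\<^sub>L y \<in> M"
    and vna_adj: "x \<in> M \<Longrightarrow> adj x \<in> M"
    and vna_closed: "closedin strong_operator_topology M"
  using assms unfolding von_neumann_algebra_def by auto

lemma vna_uminus: "von_neumann_algebra M \<Longrightarrow> x \<in> M \<Longrightarrow> - x \<in> M"
  using vna_scaleC[of M x "- 1"] by (simp add: op_scaleC_minus_one)

lemma vna_diff: "von_neumann_algebra M \<Longrightarrow> x \<in> M \<Longrightarrow> y \<in> M \<Longrightarrow> x - y \<in> M"
  using vna_add[of M x "- y"] vna_uminus[of M y] by simp

lemma vna_zero: "von_neumann_algebra M \<Longrightarrow> 0 \<in> M"
  using vna_diff[OF _ vna_id vna_id] by simp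

lemma
  assumes "state_on M \<tau>"
  shows state_add: "x \<in> M \<Longrightarrow> y \<in> M \<Longrightarrow> \<tau> (x + y) = \<tau> x + \<tau> y"
    and state_scaleC: "x \<in> M \<Longrightarrow> \<tau> (op_scaleC c x) = c * \<tau> x"
    and state_nonneg: "x \<in> M \<Longrightarrow> op_nonneg x \<Longrightarrow> \<tau> x \<in> \<real>\<^sub>\<ge>\<^sub>0"
    and state_id: "\<tau> id_blinfun = 1"
  using assms unfolding state_on_def linear_functional_on_def by auto

lemma state_diff:
  assumes "von_neumann_algebra M" "state_on M \<tau>" "x \<in> M" "y \<in> M"
  shows "\<tau> (x - y) = \<tau> x - \<tau> y"
  using state_add[OF assms(2) vna_diff[OF assms(1,3,4)] assms(4)] by simp

lemma state_zero: "von_neumann_algebra M \<Longrightarrow> state_on M \<tau> \<Longrightarrow> \<tau> 0 = 0"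
  using state_diff[OF _ _ vna_id vna_id, of M \<tau>] by simp

text \<open>The strong limit of an increasing sequence of projections is its least upper bound, to which
  normality applies.\<close>

lemma increasing_projections_trace:
  fixes p :: "nat \<Rightarrow> ('h::complex_hilbert_space \<Rightarrow>\<^sub>L 'h)"
  assumes nM: "normal_on M \<tau>" and vP: "von_neumann_algebra P" and PM: "P \<subseteq> M"
    and pP: "\<And>n. p n \<in> P" and p: "\<And>n. is_projection (p n)"
    and inc: "\<And>n. op_le (p n) (p (Suc n))"
  obtains s where "s \<in> P" "is_projection s" "\<And>n. op_le (p n) s" "Re (\<tau> s) = (SUP n. Re (\<tau> (p n)))"
proof -
  obtain s where s: "is_projection s" "\<And>x. (\<lambda>n. p n x) \<longlonglongrightarrow> s x" "\<And>n. op_le (p n) s"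
    using increasing_projections_converge[of p, OF p inc] by blast
  have sP: "s \<in> P"
    using closedin_strong_operator_topology_limit[OF vna_closed[OF vP] pP s(2)] .
  have mono: "op_le (p m) (p n)" if "m \<le> n" for m n
    using op_le_of_step[of p] inc that by blast
  have "op_directed (range p)"
    unfolding op_directed_def by (auto intro: mono[OF max.cobounded1] mono[OF max.cobounded2])
  moreover have "op_lub_in M (range p) s"
    unfolding op_lub_in_def using sP PM s(3) op_le_limit[of p, OF s(2)] by auto
  moreover have "range p \<subseteq> M" "\<forall>x\<in>range p. op_nonneg x"
    using pP PM op_nonneg_projection p by auto
  ultimately have "Re (\<tau> s) = (SUP x\<in>range p. Re (\<tau> x))"
    using nM unfolding normal_on_def by blast
  then show thesis
    using that[OF sP s(1,3)] by (simp add: image_comp)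
qed

section \<open>Projections of prescribed trace in a diffuse algebra\<close>

text \<open>A nonzero projection \<open>p\<close> is not minimal, so it splits as \<open>q + (p - q)\<close> with both parts nonzero;
  one of the parts has at most half the trace of \<open>p\<close>. Iteration makes the trace as small as desired.\<close>

lemma diffuse_small_subprojection:
  assumes vM: "von_neumann_algebra M" and st: "state_on M \<tau>"
    and vP: "von_neumann_algebra P" and PM: "P \<subseteq> M" and dP: "diffuse P"
    and p: "p \<in> P" "is_projection p" "p \<noteq> 0" and e: "0 < e"
  obtains r where "r \<in> P" "is_projection r" "r \<noteq> 0" "op_le r p" "Re (\<tau> r) \<le> e"
proof -
  have "\<exists>r\<in>P. is_projection r \<and> r \<noteq> 0 \<and> op_le r p \<and> Re (\<tau> r) \<le> Re (\<tau> p) * (1/2) ^ n" for n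
  proof (induction n)
    case 0
    show ?case
      using p op_le_refl by auto
  next
    case (Suc n)
    then obtain r where r: "r \<in> P" "is_projection r" "r \<noteq> 0" "op_le r p"
      "Re (\<tau> r) \<le> Re (\<tau> p) * (1/2) ^ n"
      by blast
    then obtain q where q: "q \<in> P" "is_projection q" "op_le q r" "q \<noteq> 0" "q \<noteq> r"
      using dP unfolding diffuse_def minimal_projection_def by blast
    have rq: "r - q \<in> P" "is_projection (r - q)" "op_le (r - q) r" "r - q \<noteq> 0"
      using q r vna_diff[OF vP] is_projection_diff op_le_diff_projection by auto
    have "Re (\<tau> (r - q)) = Re (\<tau> r) - Re (\<tau> q)"
      using state_diff[OF vM st] q r PM by (simp add: subset_iff)
    then have "Re (\<tau> q) \<le> Re (\<tau> r) / 2 \<or> Re (\<tau> (r - q)) \<le> Re (\<tau> r) / 2"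
      by linarith
    then obtain q' where "q' \<in> P" "is_projection q'" "op_le q' r" "q' \<noteq> 0" "Re (\<tau> q') \<le> Re (\<tau> r) / 2"
      using q rq by blast
    moreover from this have "Re (\<tau> q') \<le> Re (\<tau> p) * (1/2) ^ Suc n"
      using r(5) by simp
    ultimately show ?case
      using op_le_trans r(4) by blast
  qed
  moreover have "(\<lambda>n. Re (\<tau> p) * (1/2) ^ n) \<longlonglongrightarrow> Re (\<tau> p) * 0"
    by (intro tendsto_intros LIMSEQ_power_zero) simp
  then have "eventually (\<lambda>n. Re (\<tau> p) * (1/2) ^ n < e) sequentially"
    using e by (intro order_tendstoD) auto
  then obtain n where "Re (\<tau> p) * (1/2) ^ n < e"
    by (auto simp: eventually_sequentially)
  ultimately show thesis
    using that by (metis less_imp_le order_trans)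
qed

text \<open>Exhaustion: build an increasing sequence of projections of trace at most \<open>a\<close>, whose step
  number \<open>n\<close> comes within \<open>1/(n+1)\<close> of the largest trace still attainable. If the supremum had
  trace less than \<open>a\<close>, a small projection from its complement could be added, and this would
  contradict the choice of the steps.\<close>

lemma diffuse_projection_of_trace:
  assumes vM: "von_neumann_algebra M" and st: "state_on M \<tau>" and ff: "faithful_on M \<tau>"
    and nM: "normal_on M \<tau>"
    and vP: "von_neumann_algebra P" and PM: "P \<subseteq> M" and dP: "diffuse P"
    and a: "0 \<le> a" "a \<le> 1"
  obtains p where "p \<in> P" "is_projection p" "\<tau> p = of_real a"
proof -
  define t where "t = (\<lambda>p. Re (\<tau> p))"
  define X where "X = {p \<in> P. is_projection p \<and> t p \<le> a}"
  have tau_t: "\<tau> p = of_real (t p)" if "p \<in> P" "is_projection p" for p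
  proof (rule complex_eqI)
    have "\<tau> p \<in> \<real>\<^sub>\<ge>\<^sub>0"
      using state_nonneg[OF st _ op_nonneg_projection[OF that(2)]] that(1) PM by blast
    then show "Im (\<tau> p) = Im (of_real (t p))"
      by (simp add: complex_nonneg_Reals_iff)
  qed (simp add: t_def)
  have ex: "\<exists>q. q \<in> X \<and> op_le p q \<and> (\<forall>r\<in>X. op_le p r \<longrightarrow> t r \<le> t q + 1 / real (Suc n))"
    if p: "p \<in> X" for p n
  proof -
    \<comment> \<open>The traces still attainable above \<open>p\<close>.\<close>
    define Y where "Y = t ` {q \<in> X. op_le p q}"
    have Y: "Y \<noteq> {}" "bdd_above Y"
      using p op_le_refl by (auto simp: Y_def X_def intro!: bdd_aboveI[of _ a])
    then obtain y where y: "y \<in> Y" "Sup Y - 1 / real (Suc n) < y"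
      by (metis less_cSupE diff_less divide_pos_pos of_nat_0_less_iff zero_less_Suc zero_less_one diff_less_eq less_add_same_cancel1)
    from y(1) obtain q where q: "q \<in> X" "op_le p q" "y = t q"
      by (auto simp: Y_def)
    have "t r \<le> t q + 1 / real (Suc n)" if "r \<in> X" "op_le p r" for r
      using cSup_upper[OF _ Y(2), of "t r"] y(2) q(3) that by (simp add: Y_def)
    with q show ?thesis
      by blast
  qed
  have "0 \<in> X"
    using a vna_zero[OF vP] is_projection_0 state_zero[OF vM st] by (simp add: X_def t_def)
  then obtain f where f: "\<And>n. f n \<in> X" "\<And>n. op_le (f n) (f (Suc n))"
    "\<And>n r. r \<in> X \<Longrightarrow> op_le (f n) r \<Longrightarrow> t r \<le> t (f (Suc n)) + 1 / real (Suc n)"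
    using dependent_nat_choice[of "\<lambda>_ p. p \<in> X"
      "\<lambda>n p q. op_le p q \<and> (\<forall>r\<in>X. op_le p r \<longrightarrow> t r \<le> t q + 1 / real (Suc n))"] ex
    by (metis (no_types, lifting))
  have fP: "f n \<in> P" "is_projection (f n)" "t (f n) \<le> a" for n
    using f(1)[of n] by (auto simp: X_def)
  obtain s where s: "s \<in> P" "is_projection s" "\<And>n. op_le (f n) s" and ts: "t s = (SUP n. t (f n))"
    using increasing_projections_trace[of M \<tau> P f, OF nM vP PM fP(1,2) f(2)] unfolding t_def by blast
  have bdd: "bdd_above (range (\<lambda>n. t (f n)))"
    using fP(3) by (auto intro!: bdd_aboveI[of _ a])
  have tf: "t (f n) \<le> t s" for n
    unfolding ts by (rule cSUP_upper[OF _ bdd]) simp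
  have sa: "t s \<le> a"
    unfolding ts by (rule cSUP_least) (use fP(3) in auto)
  have "t s = a"
  proof (rule ccontr)
    assume "t s \<noteq> a"
    with sa have less: "t s < a"
      by simp
    have c: "id_blinfun - s \<in> P" "is_projection (id_blinfun - s)"
      using s vna_diff[OF vP vna_id[OF vP]] is_projection_diff[OF is_projection_id s(2) op_le_id_projection]
      by auto
    have "id_blinfun - s \<noteq> 0"
      using less a state_id[OF st] by (auto simp: t_def)
    then obtain r where r: "r \<in> P" "is_projection r" "r \<noteq> 0" "op_le r (id_blinfun - s)" "t r \<le> a - t s"
      using diffuse_small_subprojection[OF vM st vP PM dP c, of "a - t s"] less unfolding t_def by auto
    have "t r \<noteq> 0"
    proof
      assume "t r = 0"
      then have "\<tau> r = 0"
        using tau_t[OF r(1,2)] by simp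
      moreover have "r \<in> M"
        using r(1) PM by blast
      ultimately show False
        using ff op_nonneg_projection[OF r(2)] r(3) unfolding faithful_on_def by blast
    qed
    moreover have "0 \<le> t r"
      using state_nonneg[OF st _ op_nonneg_projection[OF r(2)]] r(1) PM
      by (auto simp: t_def complex_nonneg_Reals_iff)
    ultimately have pos: "0 < t r"
      by simp
    note sr = is_projection_add[OF s(2) r(2,4)]
    have tsr: "t (s + r) = t s + t r"
      using state_add[OF st] s(1) r(1) PM by (simp add: t_def subset_iff)
    then have "s + r \<in> X"
      using sr(1) vna_add[OF vP s(1) r(1)] r(5) by (simp add: X_def)
    \<comment> \<open>\<open>s + r\<close> was a candidate at every step, so it exceeds \<open>t (f (Suc n)) \<le> t s\<close> by at most
      \<open>1/(n+1)\<close>.\<close>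
    then have "t s + t r \<le> t s + 1 / real (Suc n)" for n
      using f(3)[of "s + r" n] op_le_trans[OF s(3) sr(2)] tf[of "Suc n"] tsr by simp
    then have "t r \<le> 1 / real (Suc n)" for n
      by (metis add_le_cancel_left)
    then show False
      using nat_approx_posE[OF pos] by (metis not_less)
  qed
  then show thesis
    using that s(1,2) tau_t by metis
qed

section \<open>The trace norm\<close>

lemma adj_compose_self_apply:
  assumes "x \<in> clinear_ops"
  shows "cinner ((adj x o\<^sub>L x) v) v = of_real ((norm (x v))\<^sup>2)"
  using assms by (simp add: cinner_adj cinner_self del: of_real_power)

lemma state_adj_compose_nonneg:
  assumes vM: "von_neumann_algebra M" and st: "state_on M \<tau>" and x: "x \<in> M"
  shows "\<tau> (adj x o\<^sub>L x) \<in> \<real>\<^sub>\<ge>\<^sub>0"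
proof (rule state_nonneg[OF st])
  show "adj x o\<^sub>L x \<in> M"
    by (intro vna_compose[OF vM] vna_adj[OF vM] x)
  show "op_nonneg (adj x o\<^sub>L x)"
    using adj_compose_self_apply[OF vna_clinear[OF vM x]]
    unfolding op_nonneg_def by (metis nonneg_Reals_of_real_iff zero_le_power2)
qed

lemma trace_norm_nonneg:
  assumes "von_neumann_algebra M" "state_on M \<tau>" "x \<in> M"
  shows "0 \<le> trace_norm \<tau> x"
  using state_adj_compose_nonneg[OF assms] by (simp add: trace_norm_def complex_nonneg_Reals_iff)

text \<open>The operator \<open>\<parallel>x\<parallel>\<^sup>2 - x\<^sup>* x\<close> is positive.\<close>

lemma trace_norm_le_norm:
  assumes vM: "von_neumann_algebra M" and st: "state_on M \<tau>" and x: "x \<in> M"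
  shows "trace_norm \<tau> x \<le> norm x"
proof -
  define d where "d = op_scaleC (of_real ((norm x)\<^sup>2)) id_blinfun - (adj x o\<^sub>L x)"
  have mem: "op_scaleC (of_real ((norm x)\<^sup>2)) id_blinfun \<in> M" "adj x o\<^sub>L x \<in> M"
    by (intro vna_scaleC[OF vM] vna_id[OF vM] vna_compose[OF vM] vna_adj[OF vM] x)+
  have "cinner (d v) v \<in> \<real>\<^sub>\<ge>\<^sub>0" for v
  proof -
    have "cinner (d v) v = of_real ((norm x * norm v)\<^sup>2 - (norm (x v))\<^sup>2)"
      unfolding d_def blinfun.diff_left cinner_diff_left adj_compose_self_apply[OF vna_clinear[OF vM x]]
      by (simp add: op_scaleC_apply cinner_scaleC_left cinner_self power_mult_distrib)
    moreover have "(norm (x v))\<^sup>2 \<le> (norm x * norm v)\<^sup>2"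
      by (intro power_mono norm_blinfun) simp
    ultimately show ?thesis
      by (metis diff_ge_0_iff_ge nonneg_Reals_of_real_iff)
  qed
  then have "\<tau> d \<in> \<real>\<^sub>\<ge>\<^sub>0"
    using mem by (intro state_nonneg[OF st]) (simp_all add: op_nonneg_def d_def vna_diff[OF vM])
  moreover have "\<tau> d = of_real ((norm x)\<^sup>2) - \<tau> (adj x o\<^sub>L x)"
    unfolding d_def using mem vna_id[OF vM]
    by (simp add: state_diff[OF vM st] state_scaleC[OF st] state_id[OF st])
  ultimately have "Re (\<tau> (adj x o\<^sub>L x)) \<le> (norm x)\<^sup>2"
    by (simp add: complex_nonneg_Reals_iff del: of_real_power)
  then show ?thesis
    unfolding trace_norm_def by (metis norm_ge_zero real_sqrt_le_iff real_sqrt_unique)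
qed

section \<open>Distances of orthogonal subalgebras\<close>

text \<open>Orthogonality applies to \<open>x\<close> and \<open>y - \<tau>(y)\<close>, and passing from \<open>y\<close> to \<open>y - \<tau>(y)\<close> changes
  \<open>\<tau>(x y)\<close> by \<open>\<tau>(y) \<tau>(x) = 0\<close>.\<close>

lemma orthogonal_trace_compose_zero:
  assumes vM: "von_neumann_algebra M" and st: "state_on M \<tau>"
    and vQ: "von_neumann_algebra Q" and PM: "P \<subseteq> M" and QM: "Q \<subseteq> M"
    and orth: "orthogonal_subalgebras \<tau> P Q"
    and x: "x \<in> P" "\<tau> x = 0" and y: "y \<in> Q"
  shows "\<tau> (x o\<^sub>L y) = 0"
proof -
  define y0 where "y0 = y - op_scaleC (\<tau> y) id_blinfun"
  have mem: "x \<in> M" "y \<in> M" "op_scaleC (\<tau> y) id_blinfun \<in> M"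
    using x y PM QM vna_scaleC[OF vM vna_id[OF vM]] by auto
  have "y0 \<in> Q"
    unfolding y0_def by (intro vna_diff[OF vQ] vna_scaleC[OF vQ] vna_id[OF vQ] y)
  moreover have "\<tau> y0 = 0"
    unfolding y0_def using mem vna_id[OF vM]
    by (simp add: state_diff[OF vM st] state_scaleC[OF st] state_id[OF st])
  ultimately have "\<tau> (x o\<^sub>L y0) = 0"
    using orth x unfolding orthogonal_subalgebras_def by blast
  moreover have "x o\<^sub>L y0 = (x o\<^sub>L y) - op_scaleC (\<tau> y) x"
    using vna_clinear[OF vM mem(1)]
    by (intro blinfun_eqI) (simp add: y0_def blinfun.diff_left blinfun.diff_right op_scaleC_apply clinear_opsD)
  ultimately show ?thesis
    using mem vna_compose[OF vM] vna_scaleC[OF vM]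
    by (simp add: state_diff[OF vM st] state_scaleC[OF st] x)
qed

text \<open>If \<open>p\<close> has trace \<open>1/2\<close>, then \<open>u = 2 p - 1\<close> is a self-adjoint unitary of trace zero. In
  \<open>\<parallel>u - y\<parallel>\<^sub>\<tau>\<^sup>2\<close> the cross term \<open>\<tau>(u y)\<close> vanishes by orthogonality, and so does
  \<open>\<tau>(y\<^sup>* u) = \<tau>(u y\<^sup>*)\<close> by the trace property, so this number is \<open>1 + \<parallel>y\<parallel>\<^sub>\<tau>\<^sup>2\<close>.\<close>

lemma ex_far_from_orthogonal:
  assumes vM: "von_neumann_algebra M" and st: "state_on M \<tau>" and ff: "faithful_on M \<tau>"
    and nM: "normal_on M \<tau>" and tr: "tracial_on M \<tau>"
    and vP: "von_neumann_algebra P" and PM: "P \<subseteq> M" and dP: "diffuse P"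
    and vQ: "von_neumann_algebra Q" and QM: "Q \<subseteq> M"
    and orth: "orthogonal_subalgebras \<tau> P Q"
  obtains u where "u \<in> unit_ball P" "\<And>y. y \<in> Q \<Longrightarrow> 1 \<le> trace_norm \<tau> (u - y)"
proof -
  obtain p where p: "p \<in> P" "is_projection p" and tp: "\<tau> p = of_real (1/2)"
    using diffuse_projection_of_trace[OF vM st ff nM vP PM dP, of "1/2"] by auto
  define u where "u = op_scaleC 2 p - id_blinfun"
  have uP: "u \<in> P"
    unfolding u_def by (intro vna_diff[OF vP] vna_scaleC[OF vP] vna_id[OF vP] p)
  then have uM: "u \<in> M"
    using PM by blast
  have tu: "\<tau> u = 0"
    unfolding u_def using p(1) PM vna_id[OF vM] vna_scaleC[OF vM]
    by (simp add: state_diff[OF vM st] state_scaleC[OF st] state_id[OF st] tp subset_iff)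
  have ux: "u x = p x + p x - x" for x
    by (simp add: u_def op_scaleC_two blinfun.diff_left blinfun.add_left)
  have uu: "u (u x) = x" for x
    using p(2) by (simp add: ux is_projection_iff blinfun.diff_right blinfun.add_right)
  have usym: "cinner (u x) y = cinner x (u y)" for x y
    using p(2) by (simp add: ux is_projection_iff cinner_add_left cinner_add_right cinner_diff_left cinner_diff_right)
  have "norm (u x) = norm x" for x
  proof -
    have "cinner (u x) (u x) = cinner x x"
      by (simp add: usym uu)
    then show ?thesis
      by (simp add: norm_eq_sqrt_cinner)
  qed
  then have "norm u \<le> 1"
    by (intro norm_blinfun_bound) auto
  with uP have ball: "u \<in> unit_ball P"
    by (simp add: unit_ball_def)
  have "1 \<le> trace_norm \<tau> (u - y)" if y: "y \<in> Q" for y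
  proof -
    have yM: "y \<in> M" "adj y \<in> M" "adj y \<in> Q"
      using y QM vna_adj[OF vQ y] by auto
    have adj: "adj (u - y) = u - adj y"
    proof (rule adj_eqI)
      show "u - y \<in> clinear_ops"
        by (intro vna_clinear[OF vM] vna_diff[OF vM] uM yM)
      show "cinner ((u - adj y) v) w = cinner v ((u - y) w)" for v w
        by (simp add: blinfun.diff_left cinner_diff_left cinner_diff_right usym
            cinner_adj[OF vna_clinear[OF vM yM(1)]])
    qed
    have expand: "adj (u - y) o\<^sub>L (u - y) =
        (id_blinfun - (u o\<^sub>L y)) - ((adj y o\<^sub>L u) - (adj y o\<^sub>L y))"
      unfolding adj by (rule blinfun_eqI) (simp add: blinfun.diff_left blinfun.diff_right uu)
    have "\<tau> (u o\<^sub>L y) = 0"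
      using orthogonal_trace_compose_zero[OF vM st vQ PM QM orth uP tu y] .
    moreover have "\<tau> (adj y o\<^sub>L u) = 0"
      using orthogonal_trace_compose_zero[OF vM st vQ PM QM orth uP tu yM(3)] tr uM yM
      unfolding tracial_on_def by metis
    ultimately have "\<tau> (adj (u - y) o\<^sub>L (u - y)) = 1 + \<tau> (adj y o\<^sub>L y)"
      unfolding expand using uM yM vna_id[OF vM]
      by (simp add: state_diff[OF vM st] state_id[OF st] vna_diff[OF vM] vna_compose[OF vM])
    then show ?thesis
      using state_adj_compose_nonneg[OF vM st yM(1)]
      by (simp add: trace_norm_def complex_nonneg_Reals_iff)
  qed
  with ball show thesis
    using that by blast
qed

text \<open>Comparison with \<open>0\<close> bounds each infimum, and hence both suprema, by \<open>1\<close>; one element that stays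
  at distance \<open>1\<close> makes the first supremum equal to \<open>1\<close>.\<close>

lemma max_SUP_INF_eq_1:
  fixes d :: "'a \<Rightarrow> 'b \<Rightarrow> real"
  assumes nonneg: "\<And>x y. x \<in> A \<Longrightarrow> y \<in> B \<Longrightarrow> 0 \<le> d x y"
    and a: "a \<in> A" "\<And>x. x \<in> A \<Longrightarrow> d x b \<le> 1"
    and b: "b \<in> B" "\<And>y. y \<in> B \<Longrightarrow> d a y \<le> 1"
    and u: "u \<in> A" "\<And>y. y \<in> B \<Longrightarrow> 1 \<le> d u y"
  shows "max (SUP x\<in>A. INF y\<in>B. d x y) (SUP y\<in>B. INF x\<in>A. d x y) = 1"
proof -
  have inf1: "(INF y\<in>B. d x y) \<le> 1" if "x \<in> A" for x
    by (rule cINF_lower2[where x = b]) (use that nonneg a b in \<open>auto intro: bdd_belowI2[of _ 0]\<close>)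
  have inf2: "(INF x\<in>A. d x y) \<le> 1" if "y \<in> B" for y
    by (rule cINF_lower2[where x = a]) (use that nonneg a b in \<open>auto intro: bdd_belowI2[of _ 0]\<close>)
  have "1 \<le> (INF y\<in>B. d u y)"
    using b(1) u(2) by (intro cINF_greatest) auto
  also have "\<dots> \<le> (SUP x\<in>A. INF y\<in>B. d x y)"
    using inf1 by (intro cSUP_upper u bdd_aboveI2)
  finally have "1 \<le> (SUP x\<in>A. INF y\<in>B. d x y)" .
  moreover have "(SUP x\<in>A. INF y\<in>B. d x y) \<le> 1"
    using a(1) inf1 by (intro cSUP_least) auto
  moreover have "(SUP y\<in>B. INF x\<in>A. d x y) \<le> 1"
    using b(1) inf2 by (intro cSUP_least) auto
  ultimately show ?thesis
    by simp
qed

theorem theoremF: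
  fixes M P Q :: "('h::complex_hilbert_space \<Rightarrow>\<^sub>L 'h) set"
    and \<tau> :: "('h \<Rightarrow>\<^sub>L 'h) \<Rightarrow> complex"
  assumes "finite_von_neumann_algebra M"
    and "state_on M \<tau>" and "faithful_on M \<tau>" and "normal_on M \<tau>" and "tracial_on M \<tau>"
    and "von_neumann_subalgebra P M" and "von_neumann_subalgebra Q M"
    and "diffuse P" and "diffuse Q"
    and "orthogonal_subalgebras \<tau> P Q"
  shows "d_KK P Q = 1 \<and> d_MT \<tau> P Q = 1"
proof -
  note st = assms(2)
  have vM: "von_neumann_algebra M" and vP: "von_neumann_algebra P" and PM: "P \<subseteq> M"
    and vQ: "von_neumann_algebra Q" and QM: "Q \<subseteq> M"
    using assms(1,6,7) by (simp_all add: finite_von_neumann_algebra_def von_neumann_subalgebra_def)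
  obtain u where u: "u \<in> unit_ball P" and far: "\<And>y. y \<in> Q \<Longrightarrow> 1 \<le> trace_norm \<tau> (u - y)"
    using ex_far_from_orthogonal[OF vM assms(2-5) vP PM assms(8) vQ QM assms(10)] by blast
  have zero: "0 \<in> unit_ball P" "0 \<in> unit_ball Q"
    using vna_zero[OF vP] vna_zero[OF vQ] by (simp_all add: unit_ball_def)
  have diffM: "x - y \<in> M" if "x \<in> unit_ball P" "y \<in> unit_ball Q" for x y
    using that PM QM vna_diff[OF vM] by (auto simp: unit_ball_def)
  have le: "trace_norm \<tau> (x - y) \<le> norm (x - y)" if "x \<in> unit_ball P" "y \<in> unit_ball Q" for x y
    by (rule trace_norm_le_norm[OF vM st diffM[OF that]])
  have far_ball: "1 \<le> trace_norm \<tau> (u - y)" if "y \<in> unit_ball Q" for y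
    using that far by (simp add: unit_ball_def)
  have norm0: "norm (x - 0) \<le> 1" if "x \<in> unit_ball P" for x
    using that by (simp add: unit_ball_def)
  have norm0': "norm (0 - y) \<le> 1" if "y \<in> unit_ball Q" for y
    using that by (simp add: unit_ball_def)
  have "d_KK P Q = 1"
    unfolding d_KK_def
  proof (rule max_SUP_INF_eq_1[where a = 0 and b = 0 and u = u])
    show "1 \<le> norm (u - y)" if "y \<in> unit_ball Q" for y
      using far_ball[OF that] le[OF u that] by linarith
  qed (use zero norm0 norm0' u in auto)
  moreover have "d_MT \<tau> P Q = 1"
    unfolding d_MT_def
  proof (rule max_SUP_INF_eq_1[where a = 0 and b = 0 and u = u])
    show "0 \<le> trace_norm \<tau> (x - y)" if "x \<in> unit_ball P" "y \<in> unit_ball Q" for x y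
      using trace_norm_nonneg[OF vM st diffM[OF that]] .
    show "trace_norm \<tau> (x - 0) \<le> 1" if "x \<in> unit_ball P" for x
      using le[OF that zero(2)] norm0[OF that] by linarith
    show "trace_norm \<tau> (0 - y) \<le> 1" if "y \<in> unit_ball Q" for y
      using le[OF zero(1) that] norm0'[OF that] by linarith
  qed (use zero u far_ball in auto)
  ultimately show ?thesis
    by blast
qed

end
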